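(* Let $G$ and $H$ be finite simple connected graphs, and let $\mathcal{C}$ be any one of the classes DDR, CDDR, DMR, DP, DR. If the Cartesian product $G\square H$ belongs to $\mathcal{C}$, then both $G$ and $H$ belong to $\mathcal{C}$.
   Context: All graphs are finite, simple and connected. $\Gamma_i(u)$ is the set of vertices at distance exactly $i$ from $u$; $A_i(G)$ is the $0/1$ matrix with $(u,v)$-entry $1$ iff $d(u,v)=i$. For a graph $G$: DDR (distance degree-regular): $|\Gamma_i(u)|=|\Gamma_i(v)|$ for all vertices $u,v$ and all $i$. CDDR (commutative distance degree-regular): $|\Gamma_i(u)\cap\Gamma_j(v)|=|\Gamma_i(v)\cap\Gamma_j(u)|$ for all vertices $u,v$ and all $1\le i,j\le\operatorname{diam}(G)$. DMR (distance mean-regular): for all $0\le h,i,j\le\operatorname{diam}(G)$ the average $\frac{1}{|\Gamma_h(u)|}\sum_{v\in\Gamma_h(u)}|\Gamma_i(u)\cap\Gamma_j(v)|$ depends only on $h,i,j$ and not on $u$. DP (distance-polynomial): for every $1\le i\le\operatorname{diam}(G)$, $A_i(G)$ is a polynomial in $A_1(G)$. DR (distance-regular): $|\Gamma_i(u)\cap\Gamma_j(v)|$ depends only on $i$, $j$ and $d(u,v)$. The Cartesian product $G\square H$ has vertex set $V(G)\times V(H)$, and $(g_1,h_1)\sim(g_2,h_2)$ iff ($g_1=g_2$ and $h_1\sim h_2$) or ($h_1=h_2$ and $g_1\sim g_2$). *)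

theory Defs
  imports "HOL-Analysis.Analysis" "HOL-Computational_Algebra.Polynomial"
begin

text \<open>
  The vertex set of a graph is the whole of a type of class \<open>finite\<close> (in particular it is
  nonempty), and the graph is given by its adjacency relation.
\<close>

type_synonym 'a graph = "('a \<times> 'a) set"

definition simple_connected_graph :: "'a::finite graph \<Rightarrow> bool" where
  "simple_connected_graph G \<longleftrightarrow> sym G \<and> irrefl G \<and> (\<forall>u v. (u, v) \<in> G\<^sup>*)"

text \<open>\<open>(u, v) \<in> G ^^ n\<close> says that there is a walk of length \<open>n\<close> from \<open>u\<close> to \<open>v\<close>; the
  minimum exists whenever \<open>G\<close> is connected.\<close>

definition gdist :: "'a::finite graph \<Rightarrow> 'a \<Rightarrow> 'a \<Rightarrow> nat" where
  "gdist G u v = (LEAST n. (u, v) \<in> G ^^ n)"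

definition gdiam :: "'a::finite graph \<Rightarrow> nat" where
  "gdiam G = Max {gdist G u v | u v. True}"

definition sphere_at :: "'a::finite graph \<Rightarrow> nat \<Rightarrow> 'a \<Rightarrow> 'a set" where
  "sphere_at G i u = {v. gdist G u v = i}"

definition dist_matrix :: "'a::finite graph \<Rightarrow> nat \<Rightarrow> real ^ 'a ^ 'a" where
  "dist_matrix G i = (\<chi> u v. if gdist G u v = i then 1 else 0)"

text \<open>Powers are iterated matrix products, since multiplication by \<open>*\<close> on the type of
  matrices is componentwise.\<close>

definition poly_matrix :: "real poly \<Rightarrow> real ^ 'n ^ 'n \<Rightarrow> real ^ 'n ^ 'n" where
  "poly_matrix p A = (\<Sum>k\<le>degree p. coeff p k *\<^sub>R (((**) A ^^ k) (mat 1)))"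

definition DDR :: "'a::finite graph \<Rightarrow> bool" where
  "DDR G \<longleftrightarrow> (\<forall>u v i. card (sphere_at G i u) = card (sphere_at G i v))"

definition CDDR :: "'a::finite graph \<Rightarrow> bool" where
  "CDDR G \<longleftrightarrow> (\<forall>u v. \<forall>i\<in>{1..gdiam G}. \<forall>j\<in>{1..gdiam G}.
     card (sphere_at G i u \<inter> sphere_at G j v) = card (sphere_at G i v \<inter> sphere_at G j u))"

text \<open>The case \<open>h = 0\<close>, \<open>i = j\<close> of \<open>DMR\<close> makes the cardinality of every sphere of radius at
  most the diameter independent of its centre, so in a graph satisfying \<open>DMR\<close> none of the
  denominators below vanishes.\<close>

definition mean_intersection :: "'a::finite graph \<Rightarrow> nat \<Rightarrow> nat \<Rightarrow> nat \<Rightarrow> 'a \<Rightarrow> real" where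
  "mean_intersection G h i j u =
     (1 / real (card (sphere_at G h u))) *
     (\<Sum>v\<in>sphere_at G h u. real (card (sphere_at G i u \<inter> sphere_at G j v)))"

definition DMR :: "'a::finite graph \<Rightarrow> bool" where
  "DMR G \<longleftrightarrow> (\<forall>h\<le>gdiam G. \<forall>i\<le>gdiam G. \<forall>j\<le>gdiam G. \<forall>u v.
     mean_intersection G h i j u = mean_intersection G h i j v)"

definition DP :: "'a::finite graph \<Rightarrow> bool" where
  "DP G \<longleftrightarrow> (\<forall>i\<in>{1..gdiam G}. \<exists>p. dist_matrix G i = poly_matrix p (dist_matrix G 1))"

definition DR :: "'a::finite graph \<Rightarrow> bool" where
  "DR G \<longleftrightarrow> (\<forall>i j u v u' v'. gdist G u v = gdist G u' v' \<longrightarrow>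
     card (sphere_at G i u \<inter> sphere_at G j v) = card (sphere_at G i u' \<inter> sphere_at G j v'))"

definition cartesian_product ::
    "'a::finite graph \<Rightarrow> 'b::finite graph \<Rightarrow> ('a \<times> 'b) graph" (infixl "\<box>" 70) where
  "G \<box> H = {((g1, h1), (g2, h2)) | g1 h1 g2 h2.
     (g1 = g2 \<and> (h1, h2) \<in> H) \<or> (h1 = h2 \<and> (g1, g2) \<in> G)}"

end

theory Submission
  imports Defs
begin

text \<open>
  Everything rests on the fact that distances in a Cartesian product add up:
  \<open>d ((g, h), (g', h')) = d (g, g') + d (h, h')\<close>.

  Four of the five classes then follow from one cancellation argument. Encode the counts that
  define the class by a generating polynomial with the distances as exponents:
  \<open>\<Sum>v. x ^ d (u, v)\<close> for DDR, \<open>\<Sum>w. x ^ d (u, w) * y ^ d (v, w)\<close> for CDDR and DR, and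
  \<open>\<Sum>v w. x ^ d (u, v) * y ^ d (u, w) * z ^ d (v, w)\<close> for DMR. Additivity of distances makes the
  polynomial of the product graph the product of the polynomials of the factors, and each class
  says that certain of these polynomials coincide. Keeping the \<open>H\<close>-coordinate of every vertex at
  one fixed \<open>h\<close> turns such a coincidence in \<open>G \<box> H\<close> into \<open>p * r = q * r\<close> with \<open>p\<close>, \<open>q\<close>
  belonging to \<open>G\<close> and \<open>r \<noteq> 0\<close> to \<open>H\<close>; polynomial rings over the integers have no zero divisors,
  so \<open>p = q\<close>. For DR and CDDR it matters here that keeping \<open>h\<close> fixed preserves the distance of
  the two vertices, and that \<open>r\<close> is the same when their roles are exchanged.

  For DP, note first that a distance-polynomial graph is DDR: its distance matrices commute with
  their sum, the all-ones matrix, so each has constant row sums. Hence \<open>G \<box> H\<close>, and by the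
  argument above also \<open>H\<close>, is DDR; let \<open>k\<^sub>j\<close> be the size of the spheres of radius \<open>j\<close> in \<open>H\<close>.
  Regard matrices over \<open>G \<box> H\<close> as block matrices indexed by \<open>G\<close>. Replacing each block by
  its row sum maps the adjacency matrix to \<open>A + k\<^sub>1 I\<close>, where \<open>A\<close> is the adjacency matrix of
  \<open>G\<close>, and polynomials in it to polynomials in \<open>A + k\<^sub>1 I\<close>, hence to polynomials in \<open>A\<close>. The
  \<open>i\<close>-th distance matrix goes to \<open>\<Sum>j\<le>i. k\<^sub>i\<^sub>-\<^sub>j A\<^sub>j\<close>. As \<open>k\<^sub>0 = 1\<close>, this system is unitriangular, and
  solving it for \<open>A\<^sub>0\<close>, \<open>A\<^sub>1\<close>, \<open>\<dots>\<close> shows that every \<open>A\<^sub>i\<close> is a polynomial in \<open>A\<close>.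
\<close>

section \<open>Distances in a connected graph and in a Cartesian product\<close>

lemma gdist_walk:
  assumes "simple_connected_graph G"
  shows "(u, v) \<in> G ^^ gdist G u v"
proof -
  have "(u, v) \<in> G\<^sup>*"
    using assms by (simp add: simple_connected_graph_def)
  then obtain n where "(u, v) \<in> G ^^ n"
    using rtrancl_power by blast
  then show ?thesis
    unfolding gdist_def by (rule LeastI)
qed

lemma gdist_le:
  assumes "(u, v) \<in> G ^^ n"
  shows "gdist G u v \<le> n"
  unfolding gdist_def using assms by (rule Least_le)

lemma gdist_eq_0_iff:
  assumes "simple_connected_graph G"
  shows "gdist G u v = 0 \<longleftrightarrow> u = v"
proof
  assume "gdist G u v = 0"
  then show "u = v" using gdist_walk[OF assms, of u v] by simp
next
  assume "u = v"
  then show "gdist G u v = 0" using gdist_le[of u v 0 G] by simp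
qed

lemma gdist_sym:
  assumes "simple_connected_graph G"
  shows "gdist G u v = gdist G v u"
proof -
  have "sym G" using assms by (simp add: simple_connected_graph_def)
  have rev: "(x, y) \<in> G ^^ n \<Longrightarrow> (y, x) \<in> G ^^ n" for x y n
  proof (induction n arbitrary: y)
    case (Suc n)
    then obtain z where "(z, x) \<in> G ^^ n" "(z, y) \<in> G" by auto
    with \<open>sym G\<close> show ?case by (meson relpow_Suc_I2 symD)
  qed simp
  have "gdist G x y \<le> gdist G y x" for x y
    by (rule gdist_le, rule rev, rule gdist_walk[OF assms])
  then show ?thesis by (simp add: order_antisym)
qed

lemma finite_gdists: "finite {gdist G u v | u v. True}"
proof -
  have "{gdist G u v | u v. True} = (\<lambda>(u, v). gdist G u v) ` UNIV"
    by (auto simp: image_def)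
  then show ?thesis by simp
qed

lemma gdist_le_gdiam: "gdist G u v \<le> gdiam G"
  unfolding gdiam_def using finite_gdists[of G] by (intro Max_ge) auto

lemma gdiam_attained: obtains u v where "gdiam G = gdist G u v"
proof -
  have "gdiam G \<in> {gdist G u v | u v. True}"
    unfolding gdiam_def using finite_gdists[of G] by (intro Max_in) auto
  then show thesis using that by blast
qed

lemma sphere_at_beyond_gdiam: "i > gdiam G \<Longrightarrow> sphere_at G i u = {}"
  using gdist_le_gdiam[of G u] by (auto simp: sphere_at_def dest: leD)

lemma sphere_at_0:
  assumes "simple_connected_graph G"
  shows "sphere_at G 0 u = {u}"
  using gdist_eq_0_iff[OF assms] by (auto simp: sphere_at_def)

text \<open>
  Each step of a walk in the product moves exactly one coordinate, so a walk is a shuffle of a walk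
  in \<open>G\<close> and one in \<open>H\<close>; conversely, the two walks can be performed one after the other.
\<close>

lemma walk_cartesian_product_iff:
  "((g, h), (g', h')) \<in> (G \<box> H) ^^ n \<longleftrightarrow>
     (\<exists>k l. n = k + l \<and> (g, g') \<in> G ^^ k \<and> (h, h') \<in> H ^^ l)"
proof
  show "((g, h), (g', h')) \<in> (G \<box> H) ^^ n \<Longrightarrow>
     \<exists>k l. n = k + l \<and> (g, g') \<in> G ^^ k \<and> (h, h') \<in> H ^^ l"
  proof (induction n arbitrary: g' h')
    case 0
    then show ?case by auto
  next
    case (Suc n)
    then obtain a b where
      walk: "((g, h), (a, b)) \<in> (G \<box> H) ^^ n" and
      step: "((a, b), (g', h')) \<in> G \<box> H"
      by auto
    obtain k l where kl: "n = k + l" "(g, a) \<in> G ^^ k" "(h, b) \<in> H ^^ l"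
      using Suc.IH[OF walk] by blast
    from step consider "a = g'" "(b, h') \<in> H" | "b = h'" "(a, g') \<in> G"
      by (auto simp: cartesian_product_def)
    then show ?case
    proof cases
      case 1
      with kl have "Suc n = k + Suc l" "(g, g') \<in> G ^^ k" "(h, h') \<in> H ^^ Suc l" by auto
      then show ?thesis by blast
    next
      case 2
      with kl have "Suc n = Suc k + l" "(g, g') \<in> G ^^ Suc k" "(h, h') \<in> H ^^ l" by auto
      then show ?thesis by blast
    qed
  qed
next
  have left: "(g, g') \<in> G ^^ k \<Longrightarrow> ((g, h), (g', h)) \<in> (G \<box> H) ^^ k" for k
  proof (induction k arbitrary: g')
    case (Suc k)
    then obtain a where "(g, a) \<in> G ^^ k" "(a, g') \<in> G" by auto
    then show ?case using Suc.IH[of a] by (auto simp: cartesian_product_def)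
  qed simp
  have right: "(h, h') \<in> H ^^ l \<Longrightarrow> ((g', h), (g', h')) \<in> (G \<box> H) ^^ l" for l
  proof (induction l arbitrary: h')
    case (Suc l)
    then obtain b where "(h, b) \<in> H ^^ l" "(b, h') \<in> H" by auto
    then show ?case using Suc.IH[of b] by (auto simp: cartesian_product_def)
  qed simp
  show "\<exists>k l. n = k + l \<and> (g, g') \<in> G ^^ k \<and> (h, h') \<in> H ^^ l \<Longrightarrow>
     ((g, h), (g', h')) \<in> (G \<box> H) ^^ n"
    using relcompI[OF left right] by (auto simp: relpow_add)
qed

lemma gdist_cartesian_product:
  assumes "simple_connected_graph G" "simple_connected_graph H"
  shows "gdist (G \<box> H) (g, h) (g', h') = gdist G g g' + gdist H h h'"
  unfolding gdist_def[of "G \<box> H"] walk_cartesian_product_iff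
proof (rule Least_equality)
  show "\<exists>k l. gdist G g g' + gdist H h h' = k + l \<and> (g, g') \<in> G ^^ k \<and> (h, h') \<in> H ^^ l"
    using gdist_walk[OF assms(1)] gdist_walk[OF assms(2)] by blast
next
  fix n assume "\<exists>k l. n = k + l \<and> (g, g') \<in> G ^^ k \<and> (h, h') \<in> H ^^ l"
  then show "gdist G g g' + gdist H h h' \<le> n"
    by (auto intro!: add_mono gdist_le)
qed

lemma simple_connected_graph_cartesian_product:
  assumes "simple_connected_graph G" "simple_connected_graph H"
  shows "simple_connected_graph (G \<box> H)"
  unfolding simple_connected_graph_def
proof (intro conjI allI)
  show "sym (G \<box> H)" and "irrefl (G \<box> H)"
    using assms
    by (auto simp: simple_connected_graph_def cartesian_product_def sym_def irrefl_def)
next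
  fix u v :: "'a \<times> 'b"
  obtain g h g' h' where uv: "u = (g, h)" "v = (g', h')" by fastforce
  have "(u, v) \<in> (G \<box> H) ^^ (gdist G g g' + gdist H h h')"
    unfolding uv walk_cartesian_product_iff using gdist_walk[OF assms(1)] gdist_walk[OF assms(2)] by blast
  then show "(u, v) \<in> (G \<box> H)\<^sup>*"
    by (rule relpow_imp_rtrancl)
qed

section \<open>Generating polynomials of the distance counts\<close>

text \<open>
  Polynomials in several variables are nested: in \<open>pair_poly\<close> the outer variable marks the
  distance from \<open>v\<close>, in \<open>triple_poly\<close> the outermost one marks the distance between the two
  summation vertices.
\<close>

definition sphere_poly :: "'a::finite graph \<Rightarrow> 'a \<Rightarrow> int poly" where
  "sphere_poly G u = (\<Sum>v\<in>UNIV. monom 1 (gdist G u v))"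

definition pair_poly :: "'a::finite graph \<Rightarrow> 'a \<Rightarrow> 'a \<Rightarrow> int poly poly" where
  "pair_poly G u v = (\<Sum>w\<in>UNIV. monom (monom 1 (gdist G u w)) (gdist G v w))"

definition triple_poly :: "'a::finite graph \<Rightarrow> 'a \<Rightarrow> int poly poly poly" where
  "triple_poly G u =
     (\<Sum>v\<in>UNIV. \<Sum>w\<in>UNIV. monom (monom (monom 1 (gdist G u v)) (gdist G u w)) (gdist G v w))"

lemma coeff_sphere_poly: "coeff (sphere_poly G u) i = int (card (sphere_at G i u))"
  by (simp add: sphere_poly_def coeff_sum sphere_at_def sum.If_cases)

lemma coeff_pair_poly:
  "coeff (coeff (pair_poly G u v) j) i = int (card (sphere_at G i u \<inter> sphere_at G j v))"
proof -
  have "coeff (coeff (monom (monom (1::int) a) b) j) i = (if a = i \<and> b = j then 1 else 0)"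
    for a b by auto
  then show ?thesis
    by (simp add: pair_poly_def coeff_sum sphere_at_def sum.If_cases Collect_conj_eq
        del: coeff_monom)
qed

lemma coeff_triple_poly:
  "coeff (coeff (coeff (triple_poly G u) j) i) h =
     int (\<Sum>v\<in>sphere_at G h u. card (sphere_at G i u \<inter> sphere_at G j v))"
proof -
  have "coeff (coeff (coeff (triple_poly G u) j) i) h =
    (\<Sum>v\<in>UNIV. if v \<in> sphere_at G h u
       then (\<Sum>w\<in>UNIV. if w \<in> sphere_at G i u \<inter> sphere_at G j v then 1 else 0) else 0)"
    unfolding triple_poly_def coeff_sum
    by (intro sum.cong) (auto intro!: sum.cong sum.neutral simp: sphere_at_def)
  also have "\<dots> = int (\<Sum>v\<in>sphere_at G h u. card (sphere_at G i u \<inter> sphere_at G j v))"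
    by (simp add: sum.If_cases Int_def)
  finally show ?thesis .
qed

lemma sphere_poly_nonzero: "sphere_poly G u \<noteq> 0"
proof
  assume "sphere_poly G u = 0"
  then have "card (sphere_at G (gdist G u u) u) = 0"
    using coeff_sphere_poly[of G u "gdist G u u"] by simp
  then show False by (auto simp: sphere_at_def)
qed

lemma pair_poly_nonzero: "pair_poly G u v \<noteq> 0"
proof
  assume "pair_poly G u v = 0"
  then have "card (sphere_at G (gdist G u u) u \<inter> sphere_at G (gdist G v u) v) = 0"
    using coeff_pair_poly[of G u v "gdist G v u" "gdist G u u"] by simp
  then show False by (auto simp: sphere_at_def)
qed

lemma triple_poly_nonzero: "triple_poly G u \<noteq> 0"
proof
  let ?d = "gdist G u u"
  assume "triple_poly G u = 0"
  then have "int (\<Sum>v\<in>sphere_at G ?d u. card (sphere_at G ?d u \<inter> sphere_at G ?d v)) = 0"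
    using coeff_triple_poly[of G u ?d ?d ?d] by (simp del: of_nat_sum)
  then have "\<forall>v\<in>sphere_at G ?d u. sphere_at G ?d u \<inter> sphere_at G ?d v = {}"
    unfolding of_nat_eq_0_iff by simp
  then show False by (auto simp: sphere_at_def)
qed

text \<open>
  The classes become equalities of polynomials, in which all indices occur, also those beyond the
  diameter.
\<close>

lemma DDR_iff_sphere_poly: "DDR G \<longleftrightarrow> (\<forall>u v. sphere_poly G u = sphere_poly G v)"
  unfolding DDR_def poly_eq_iff coeff_sphere_poly of_nat_eq_iff by blast

lemma pair_poly_eq_iff:
  "pair_poly G u v = pair_poly G u' v' \<longleftrightarrow>
     (\<forall>i j. card (sphere_at G i u \<inter> sphere_at G j v) = card (sphere_at G i u' \<inter> sphere_at G j v'))"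
  unfolding poly_eq_iff coeff_pair_poly of_nat_eq_iff by blast

lemma DR_iff_pair_poly:
  "DR G \<longleftrightarrow> (\<forall>u v u' v'. gdist G u v = gdist G u' v' \<longrightarrow> pair_poly G u v = pair_poly G u' v')"
  unfolding DR_def pair_poly_eq_iff by blast

text \<open>
  The definition of CDDR leaves out the indices \<open>0\<close> and those beyond the diameter. There the
  equality is automatic: a sphere of radius \<open>0\<close> is a single vertex, and its count only tests the
  value of the symmetric distance between \<open>u\<close> and \<open>v\<close>; beyond the diameter all spheres are empty.
\<close>

lemma CDDR_iff_pair_poly:
  assumes G: "simple_connected_graph G"
  shows "CDDR G \<longleftrightarrow> (\<forall>u v. pair_poly G u v = pair_poly G v u)"
proof
  assume "\<forall>u v. pair_poly G u v = pair_poly G v u"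
  then show "CDDR G" unfolding CDDR_def pair_poly_eq_iff by blast
next
  assume C: "CDDR G"
  have "card (sphere_at G i u \<inter> sphere_at G j v) = card (sphere_at G i v \<inter> sphere_at G j u)"
    for u v i j
  proof -
    consider "i = 0" | "j = 0" | "i > gdiam G" | "j > gdiam G"
      | "i \<in> {1..gdiam G}" "j \<in> {1..gdiam G}"
      by force
    then show ?thesis
    proof cases
      case 1
      then show ?thesis using gdist_sym[OF G, of u v]
        by (simp add: sphere_at_0[OF G] Int_insert_left Int_insert_right) (simp add: sphere_at_def)
    next
      case 2
      then show ?thesis using gdist_sym[OF G, of u v]
        by (simp add: sphere_at_0[OF G] Int_insert_left Int_insert_right) (simp add: sphere_at_def)
    next
      case 5
      then show ?thesis using C by (simp add: CDDR_def)
    qed (simp_all add: sphere_at_beyond_gdiam)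
  qed
  then show "\<forall>u v. pair_poly G u v = pair_poly G v u"
    unfolding pair_poly_eq_iff by blast
qed

lemma mean_intersection_eq:
  "mean_intersection G h i j u =
     of_int (coeff (coeff (coeff (triple_poly G u) j) i) h) / real (card (sphere_at G h u))"
  by (simp add: mean_intersection_def coeff_triple_poly)

lemma card_sphere_at_eq_coeff_triple_poly:
  assumes G: "simple_connected_graph G"
  shows "int (card (sphere_at G i u)) = coeff (coeff (coeff (triple_poly G u) i) i) 0"
  by (simp add: coeff_triple_poly sphere_at_0[OF G])

text \<open>
  Means and sums carry the same information once the sphere sizes do not depend on the centre.
  Both sides imply this: the means through \<open>h = 0\<close>, \<open>i = j\<close>, and \<open>triple_poly\<close> through the
  corresponding coefficient.
\<close>

lemma DMR_iff_triple_poly: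
  assumes G: "simple_connected_graph G"
  shows "DMR G \<longleftrightarrow> (\<forall>u v. triple_poly G u = triple_poly G v)"
proof
  assume T: "\<forall>u v. triple_poly G u = triple_poly G v"
  then have "card (sphere_at G i u) = card (sphere_at G i v)" for i u v
    by (metis card_sphere_at_eq_coeff_triple_poly[OF G] of_nat_eq_iff)
  then show "DMR G"
    unfolding DMR_def mean_intersection_eq using T by metis
next
  assume D: "DMR G"
  have sphere: "card (sphere_at G i u) = card (sphere_at G i v)" for i u v
  proof (cases "i \<le> gdiam G")
    case True
    then have "mean_intersection G 0 i i u = mean_intersection G 0 i i v"
      using D unfolding DMR_def by blast
    then show ?thesis by (simp add: mean_intersection_def sphere_at_0[OF G])
  qed (simp add: sphere_at_beyond_gdiam)
  have "coeff (coeff (coeff (triple_poly G u) j) i) h = coeff (coeff (coeff (triple_poly G v) j) i) h"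
    for u v h i j
  proof (cases "sphere_at G h u = {} \<or> gdiam G < i \<or> gdiam G < j")
    case True
    moreover have "sphere_at G h u = {} \<longleftrightarrow> sphere_at G h v = {}"
      using sphere[of h u v] by (metis card_0_eq finite)
    ultimately show ?thesis
      by (auto simp: coeff_triple_poly sphere_at_beyond_gdiam)
  next
    case False
    then have "h \<le> gdiam G" using sphere_at_beyond_gdiam[of G h u] by force
    with False have "mean_intersection G h i j u = mean_intersection G h i j v"
      using D unfolding DMR_def by (metis not_less)
    moreover have "card (sphere_at G h u) \<noteq> 0" using False by simp
    ultimately show ?thesis
      by (simp add: mean_intersection_eq sphere[of h v u])
  qed
  then show "\<forall>u v. triple_poly G u = triple_poly G v"
    by (simp add: poly_eq_iff)
qed

section \<open>Polynomials in a matrix\<close>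

abbreviation matrix_power :: "real ^ 'n ^ 'n \<Rightarrow> nat \<Rightarrow> real ^ 'n ^ 'n" where
  "matrix_power A k \<equiv> ((**) A ^^ k) (mat 1)"

definition matrix_algebra :: "real ^ 'n ^ 'n \<Rightarrow> (real ^ 'n ^ 'n) set" where
  "matrix_algebra A = span (range (matrix_power A))"

lemma poly_matrix_altdef:
  assumes "degree p \<le> n"
  shows "poly_matrix p A = (\<Sum>k\<le>n. coeff p k *\<^sub>R matrix_power A k)"
  unfolding poly_matrix_def
  using assms by (intro sum.mono_neutral_left) (auto simp: coeff_eq_0)

text \<open>
  Describing the polynomials in \<open>A\<close> as a linear span of powers gives the closure properties and an
  induction principle without computing with coefficients.
\<close>

lemma matrix_algebra_eq_range_poly_matrix:
  "matrix_algebra A = range (\<lambda>p. poly_matrix p A)"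
proof
  show "range (\<lambda>p. poly_matrix p A) \<subseteq> matrix_algebra A"
    unfolding matrix_algebra_def poly_matrix_def
    by (intro image_subsetI span_sum span_scale span_base rangeI)
next
  have "subspace (range (\<lambda>p. poly_matrix p A))"
  proof (rule subspaceI)
    have "poly_matrix 0 A = 0" by (simp add: poly_matrix_def)
    then show "0 \<in> range (\<lambda>p. poly_matrix p A)" by (metis rangeI)
  next
    fix x y assume "x \<in> range (\<lambda>p. poly_matrix p A)" "y \<in> range (\<lambda>p. poly_matrix p A)"
    then obtain p q where pq: "x = poly_matrix p A" "y = poly_matrix q A" by auto
    define n where "n = max (degree p) (degree q)"
    have "degree p \<le> n" "degree q \<le> n" "degree (p + q) \<le> n"
      by (auto simp: n_def degree_add_le)
    then have "x + y = poly_matrix (p + q) A"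
      by (simp add: pq poly_matrix_altdef[of _ n] scaleR_add_left sum.distrib)
    then show "x + y \<in> range (\<lambda>p. poly_matrix p A)" by simp
  next
    fix c x assume "x \<in> range (\<lambda>p. poly_matrix p A)"
    then obtain p where p: "x = poly_matrix p A" by auto
    have "c *\<^sub>R x = poly_matrix (smult c p) A"
      by (simp add: p poly_matrix_altdef[of _ "degree p"] degree_smult_le scaleR_sum_right)
    then show "c *\<^sub>R x \<in> range (\<lambda>p. poly_matrix p A)" by simp
  qed
  moreover have "range (matrix_power A) \<subseteq> range (\<lambda>p. poly_matrix p A)"
  proof (rule image_subsetI)
    fix k
    have "matrix_power A k = poly_matrix (monom 1 k) A"
      by (simp add: poly_matrix_altdef[of _ k] degree_monom_le if_distrib[of "\<lambda>c. c *\<^sub>R _"]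
          cong: if_cong)
    then show "matrix_power A k \<in> range (\<lambda>p. poly_matrix p A)" by simp
  qed
  ultimately show "matrix_algebra A \<subseteq> range (\<lambda>p. poly_matrix p A)"
    unfolding matrix_algebra_def by (rule span_minimal[rotated])
qed

lemma matrix_algebra_closed:
  shows matrix_algebra_one: "mat 1 \<in> matrix_algebra A"
    and matrix_algebra_add: "M \<in> matrix_algebra A \<Longrightarrow> N \<in> matrix_algebra A \<Longrightarrow> M + N \<in> matrix_algebra A"
    and matrix_algebra_scaleR: "M \<in> matrix_algebra A \<Longrightarrow> c *\<^sub>R M \<in> matrix_algebra A"
    and matrix_algebra_zero: "0 \<in> matrix_algebra A"
    and matrix_algebra_diff: "M \<in> matrix_algebra A \<Longrightarrow> N \<in> matrix_algebra A \<Longrightarrow> M - N \<in> matrix_algebra A"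
    and matrix_algebra_sum: "(\<And>i. i \<in> I \<Longrightarrow> f i \<in> matrix_algebra A) \<Longrightarrow> sum f I \<in> matrix_algebra A"
proof -
  have "matrix_power A 0 \<in> matrix_algebra A"
    unfolding matrix_algebra_def by (rule span_base) (rule rangeI)
  then show "mat 1 \<in> matrix_algebra A" by simp
qed (auto simp: matrix_algebra_def intro: span_add span_scale span_zero span_diff span_sum)

lemma matrix_algebra_induct [consumes 1, case_names one add scaleR mult]:
  assumes "M \<in> matrix_algebra A"
    and one: "P (mat 1)"
    and add: "\<And>M N. P M \<Longrightarrow> P N \<Longrightarrow> P (M + N)"
    and scaleR: "\<And>c M. P M \<Longrightarrow> P (c *\<^sub>R M)"
    and mult: "\<And>M. P M \<Longrightarrow> P (A ** M)"
  shows "P M"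
proof -
  have power: "P (matrix_power A k)" for k
    by (induction k) (auto intro: one mult)
  have zero: "P 0" using scaleR[OF one, of 0] by simp
  from assms(1) show ?thesis
    unfolding matrix_algebra_def
    by (induction rule: span_induct_alt) (auto intro: add scaleR zero power)
qed

lemma matrix_algebra_mult:
  assumes "M \<in> matrix_algebra A"
  shows "A ** M \<in> matrix_algebra A"
proof -
  have "linear ((**) A)"
    by (auto intro!: linearI simp: matrix_add_ldistrib matrix_scalar_ac simp flip: scalar_matrix_assoc)
  then have "(**) A ` matrix_algebra A = span ((**) A ` range (matrix_power A))"
    unfolding matrix_algebra_def by (rule linear_span_image[symmetric])
  also have "\<dots> \<subseteq> matrix_algebra A"
  proof -
    have "A ** matrix_power A k = matrix_power A (Suc k)" for k by simp
    then have "(**) A ` range (matrix_power A) \<subseteq> range (matrix_power A)" by blast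
    then show ?thesis unfolding matrix_algebra_def by (rule span_mono)
  qed
  finally show ?thesis using assms by blast
qed

lemma matrix_add_rdistrib:
  fixes A B :: "real ^ 'n ^ 'm" and C :: "real ^ 'k ^ 'n"
  shows "(A + B) ** C = A ** C + B ** C"
  by (simp add: matrix_matrix_mult_def vec_eq_iff sum.distrib distrib_right)

lemma matrix_algebra_commute_generator:
  assumes "M \<in> matrix_algebra A"
  shows "A ** M = M ** A"
  using assms
proof (induction rule: matrix_algebra_induct)
  case (scaleR c M)
  then show ?case by (simp add: matrix_scalar_ac flip: scalar_matrix_assoc)
qed (auto simp: matrix_add_ldistrib matrix_add_rdistrib matrix_mul_assoc)

lemma matrix_algebra_commute:
  assumes "M \<in> matrix_algebra A" "N \<in> matrix_algebra A"
  shows "M ** N = N ** M"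
  using assms(1)
proof (induction rule: matrix_algebra_induct)
  case (scaleR c M)
  then show ?case by (simp add: matrix_scalar_ac flip: scalar_matrix_assoc)
next
  case (mult M)
  then show ?case
    by (metis matrix_algebra_commute_generator[OF assms(2)] matrix_mul_assoc)
qed (auto simp: matrix_add_ldistrib matrix_add_rdistrib)

lemma dist_matrix_0:
  assumes "simple_connected_graph G"
  shows "dist_matrix G 0 = mat 1"
  by (simp add: dist_matrix_def mat_def vec_eq_iff gdist_eq_0_iff[OF assms])

lemma dist_matrix_beyond_gdiam: "i > gdiam G \<Longrightarrow> dist_matrix G i = 0"
  using gdist_le_gdiam[of G] by (auto simp: dist_matrix_def vec_eq_iff dest: leD)

lemma DP_iff_matrix_algebra:
  assumes G: "simple_connected_graph G"
  shows "DP G \<longleftrightarrow> (\<forall>i\<le>gdiam G. dist_matrix G i \<in> matrix_algebra (dist_matrix G 1))"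
proof -
  have "DP G \<longleftrightarrow> (\<forall>i\<in>{1..gdiam G}. dist_matrix G i \<in> matrix_algebra (dist_matrix G 1))"
    by (auto simp: DP_def matrix_algebra_eq_range_poly_matrix)
  moreover have "dist_matrix G 0 \<in> matrix_algebra (dist_matrix G 1)"
    by (simp add: dist_matrix_0[OF G] matrix_algebra_one)
  ultimately show ?thesis
    by (metis atLeastAtMost_iff le_zero_eq not_less_eq_eq One_nat_def)
qed

lemma row_sum_dist_matrix: "(\<Sum>v\<in>UNIV. dist_matrix G i $ u $ v) = real (card (sphere_at G i u))"
  by (simp add: dist_matrix_def sphere_at_def sum.If_cases)

text \<open>
  With \<open>J\<close> the all-ones matrix, the \<open>(u, v)\<close>-entries of \<open>A\<^sub>i J\<close> and \<open>J A\<^sub>i\<close> are the sizes of the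
  \<open>i\<close>-spheres around \<open>u\<close> and around \<open>v\<close>. As \<open>J\<close> is the sum of all \<open>A\<^sub>i\<close>, both products agree.
\<close>

lemma DP_imp_DDR:
  assumes G: "simple_connected_graph G" and "DP G"
  shows "DDR G"
  unfolding DDR_def
proof (intro allI)
  fix u v i
  let ?A = "matrix_algebra (dist_matrix G 1)"
  define J :: "real ^ 'a ^ 'a" where "J = (\<Sum>i\<le>gdiam G. dist_matrix G i)"
  have mem: "dist_matrix G i \<in> ?A" for i
    using assms DP_iff_matrix_algebra[OF G] dist_matrix_beyond_gdiam[of G i] matrix_algebra_zero
    by (metis not_less)
  have J: "J $ x $ y = 1" for x y
    using gdist_le_gdiam[of G x y] by (simp add: J_def dist_matrix_def)
  have "J \<in> ?A" unfolding J_def by (intro matrix_algebra_sum mem)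
  then have "(dist_matrix G i ** J) $ u $ v = (J ** dist_matrix G i) $ u $ v"
    using matrix_algebra_commute[OF mem] by metis
  then have "(\<Sum>w\<in>UNIV. dist_matrix G i $ u $ w) = (\<Sum>w\<in>UNIV. dist_matrix G i $ w $ v)"
    by (simp add: matrix_matrix_mult_def J)
  also have "\<dots> = (\<Sum>w\<in>UNIV. dist_matrix G i $ v $ w)"
    by (simp add: dist_matrix_def gdist_sym[OF G, of _ v])
  finally show "card (sphere_at G i u) = card (sphere_at G i v)"
    by (simp add: row_sum_dist_matrix)
qed

section \<open>Passing from a product to a factor\<close>

text \<open>
  The labelling \<open>e\<close> of the vertices of the product by pairs lets each result be proved for the left
  factor only: the right factor is obtained from the labelling that swaps the coordinates.
\<close>

locale metric_product =
  fixes G :: "'a::finite graph" and H :: "'b::finite graph" and K :: "'c::finite graph"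
    and e :: "'a \<Rightarrow> 'b \<Rightarrow> 'c"
  assumes G: "simple_connected_graph G" and H: "simple_connected_graph H"
    and K: "simple_connected_graph K"
    and bij_e: "bij (\<lambda>(g, h). e g h)"
    and gdist_e: "gdist K (e g h) (e g' h') = gdist G g g' + gdist H h h'"
begin

lemma sum_over_product: "(\<Sum>w\<in>UNIV. f w) = (\<Sum>g\<in>UNIV. \<Sum>h\<in>UNIV. f (e g h))"
proof -
  have "(\<Sum>w\<in>UNIV. f w) = (\<Sum>p\<in>UNIV. f (case p of (g, h) \<Rightarrow> e g h))"
    using sum.reindex_bij_betw[OF bij_e, of f] by simp
  also have "\<dots> = (\<Sum>g\<in>UNIV. \<Sum>h\<in>UNIV. f (e g h))"
    by (simp add: sum.cartesian_product case_prod_unfold flip: UNIV_Times_UNIV)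
  finally show ?thesis .
qed

lemma sphere_poly_product: "sphere_poly K (e g h) = sphere_poly G g * sphere_poly H h"
  by (simp add: sphere_poly_def sum_over_product gdist_e mult_monom sum_product)

lemma pair_poly_product: "pair_poly K (e g h) (e g' h') = pair_poly G g g' * pair_poly H h h'"
  by (simp add: pair_poly_def sum_over_product gdist_e mult_monom sum_product)

lemma triple_poly_product: "triple_poly K (e g h) = triple_poly G g * triple_poly H h"
proof -
  have "triple_poly K (e g h) =
    (\<Sum>g1\<in>UNIV. \<Sum>h1\<in>UNIV. \<Sum>g2\<in>UNIV. \<Sum>h2\<in>UNIV.
       monom (monom (monom 1 (gdist G g g1)) (gdist G g g2)) (gdist G g1 g2) *
       monom (monom (monom 1 (gdist H h h1)) (gdist H h h2)) (gdist H h1 h2))"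
    by (simp add: triple_poly_def sum_over_product gdist_e mult_monom)
  also have "\<dots> = triple_poly G g * triple_poly H h"
    by (simp add: triple_poly_def sum_product)
  finally show ?thesis .
qed

lemma DDR_factor:
  assumes "DDR K" shows "DDR G"
  unfolding DDR_iff_sphere_poly
proof (intro allI)
  fix g g'
  have "sphere_poly G g * sphere_poly H undefined = sphere_poly G g' * sphere_poly H undefined"
    using assms unfolding DDR_iff_sphere_poly by (metis sphere_poly_product)
  then show "sphere_poly G g = sphere_poly G g'" using sphere_poly_nonzero[of H undefined] by simp
qed

lemma CDDR_factor:
  assumes "CDDR K" shows "CDDR G"
  unfolding CDDR_iff_pair_poly[OF G]
proof (intro allI)
  fix g g'
  have "pair_poly G g g' * pair_poly H undefined undefined =
        pair_poly G g' g * pair_poly H undefined undefined"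
    using assms unfolding CDDR_iff_pair_poly[OF K] by (metis pair_poly_product)
  then show "pair_poly G g g' = pair_poly G g' g" using pair_poly_nonzero[of H undefined undefined] by simp
qed

lemma DMR_factor:
  assumes "DMR K" shows "DMR G"
  unfolding DMR_iff_triple_poly[OF G]
proof (intro allI)
  fix g g'
  have "triple_poly G g * triple_poly H undefined = triple_poly G g' * triple_poly H undefined"
    using assms unfolding DMR_iff_triple_poly[OF K] by (metis triple_poly_product)
  then show "triple_poly G g = triple_poly G g'" using triple_poly_nonzero[of H undefined] by simp
qed

lemma DR_factor:
  assumes "DR K" shows "DR G"
  unfolding DR_iff_pair_poly
proof (intro allI impI)
  fix u v u' v' assume "gdist G u v = gdist G u' v'"
  then have "gdist K (e u undefined) (e v undefined) = gdist K (e u' undefined) (e v' undefined)"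
    by (simp add: gdist_e)
  then have "pair_poly G u v * pair_poly H undefined undefined =
        pair_poly G u' v' * pair_poly H undefined undefined"
    using assms unfolding DR_iff_pair_poly by (metis pair_poly_product)
  then show "pair_poly G u v = pair_poly G u' v'" using pair_poly_nonzero[of H undefined undefined] by simp
qed

text \<open>
  A vertex in the block of \<open>g'\<close> is at distance \<open>i\<close> from \<open>e g h\<close> iff its \<open>H\<close>-coordinate is at
  distance \<open>i - d (g, g')\<close> from \<open>h\<close>. The right-hand sum has at most one nonzero term, the one for
  \<open>j = d (g, g')\<close>; the bound \<open>j \<le> i\<close> keeps the subtraction from being truncated.
\<close>

lemma block_row_sum_dist_matrix:
  "(\<Sum>h'\<in>UNIV. dist_matrix K i $ e g h $ e g' h') =
     (\<Sum>j\<le>i. real (card (sphere_at H (i - j) h)) * dist_matrix G j $ g $ g')"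
proof -
  have "(\<Sum>j\<le>i. real (card (sphere_at H (i - j) h)) * dist_matrix G j $ g $ g') =
        (\<Sum>j\<le>i. if gdist G g g' = j then real (card (sphere_at H (i - j) h)) else 0)"
    by (rule sum.cong) (auto simp: dist_matrix_def)
  also have "\<dots> = (if gdist G g g' \<le> i then real (card (sphere_at H (i - gdist G g g') h)) else 0)"
    by simp
  also have "\<dots> = (\<Sum>h'\<in>UNIV. if gdist G g g' + gdist H h h' = i then 1 else 0)"
    by (auto simp: sum.If_cases sphere_at_def intro!: arg_cong[where f = card])
  also have "\<dots> = (\<Sum>h'\<in>UNIV. dist_matrix K i $ e g h $ e g' h')"
    by (simp add: dist_matrix_def gdist_e)
  finally show ?thesis by simp
qed

text \<open>
  Taking row sums of blocks is multiplicative on matrices whose row sums do not depend on the row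
  chosen inside the block. This independence of \<open>h\<close> is carried along in the induction;
  multiplying by the adjacency matrix preserves it because \<open>H\<close> is regular.
\<close>

lemma block_row_sum_in_matrix_algebra:
  assumes "DDR H" and "M \<in> matrix_algebra (dist_matrix K 1)"
  shows "\<exists>N\<in>matrix_algebra (dist_matrix G 1).
           \<forall>g h g'. (\<Sum>h'\<in>UNIV. M $ e g h $ e g' h') = N $ g $ g'"
  using assms(2)
proof (induction rule: matrix_algebra_induct)
  case one
  have "(\<Sum>h'\<in>UNIV. (mat 1 :: real ^ 'c ^ 'c) $ e g h $ e g' h') = mat 1 $ g $ g'" for g h g'
    using block_row_sum_dist_matrix[of 0 g h g']
    by (simp add: dist_matrix_0[OF K] dist_matrix_0[OF G] sphere_at_0[OF H])
  then show ?case using matrix_algebra_one by blast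
next
  case (add M M')
  then obtain N N' where
    "N \<in> matrix_algebra (dist_matrix G 1)" "N' \<in> matrix_algebra (dist_matrix G 1)"
    "\<And>g h g'. (\<Sum>h'\<in>UNIV. M $ e g h $ e g' h') = N $ g $ g'"
    "\<And>g h g'. (\<Sum>h'\<in>UNIV. M' $ e g h $ e g' h') = N' $ g $ g'"
    by blast
  then show ?case
    by (intro bexI[of _ "N + N'"]) (auto simp: sum.distrib intro: matrix_algebra_add)
next
  case (scaleR c M)
  then obtain N where
    "N \<in> matrix_algebra (dist_matrix G 1)"
    "\<And>g h g'. (\<Sum>h'\<in>UNIV. M $ e g h $ e g' h') = N $ g $ g'"
    by blast
  then show ?case
    by (intro bexI[of _ "c *\<^sub>R N"]) (auto simp flip: sum_distrib_left intro: matrix_algebra_scaleR)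
next
  case (mult M)
  then obtain N where
    N: "N \<in> matrix_algebra (dist_matrix G 1)" and
    sum_N: "\<And>g h g'. (\<Sum>h'\<in>UNIV. M $ e g h $ e g' h') = N $ g $ g'"
    by blast
  \<comment> \<open>the valency of \<open>H\<close>\<close>
  define k where "k = real (card (sphere_at H 1 undefined))"
  have k: "real (card (sphere_at H 1 h)) = k" for h
    using assms(1) unfolding DDR_def k_def by metis
  have "(\<Sum>h'\<in>UNIV. (dist_matrix K 1 ** M) $ e g h $ e g' h') =
        (dist_matrix G 1 ** N + k *\<^sub>R N) $ g $ g'" for g h g'
  proof -
    have "(\<Sum>h'\<in>UNIV. (dist_matrix K 1 ** M) $ e g h $ e g' h') =
      (\<Sum>h'\<in>UNIV. \<Sum>w\<in>UNIV. dist_matrix K 1 $ e g h $ w * M $ w $ e g' h')"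
      by (simp add: matrix_matrix_mult_def)
    also have "\<dots> = (\<Sum>w\<in>UNIV. dist_matrix K 1 $ e g h $ w * (\<Sum>h'\<in>UNIV. M $ w $ e g' h'))"
      by (subst sum.swap) (simp add: sum_distrib_left)
    also have "\<dots> = (\<Sum>a\<in>UNIV. \<Sum>b\<in>UNIV. dist_matrix K 1 $ e g h $ e a b * N $ a $ g')"
      by (simp add: sum_over_product sum_N)
    also have "\<dots> = (\<Sum>a\<in>UNIV. (dist_matrix G 1 $ g $ a + k * mat 1 $ g $ a) * N $ a $ g')"
      using k by (simp add: block_row_sum_dist_matrix sphere_at_0[OF H] dist_matrix_0[OF G] add.commute
          flip: sum_distrib_right)
    also have "\<dots> = (\<Sum>a\<in>UNIV. dist_matrix G 1 $ g $ a * N $ a $ g') +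
                    (\<Sum>a\<in>UNIV. if g = a then k * N $ a $ g' else 0)"
      unfolding sum.distrib[symmetric] by (rule sum.cong) (auto simp: mat_def algebra_simps)
    also have "\<dots> = (dist_matrix G 1 ** N + k *\<^sub>R N) $ g $ g'"
      by (simp add: matrix_matrix_mult_def)
    finally show ?thesis .
  qed
  moreover have "dist_matrix G 1 ** N + k *\<^sub>R N \<in> matrix_algebra (dist_matrix G 1)"
    by (intro matrix_algebra_add matrix_algebra_mult matrix_algebra_scaleR N)
  ultimately show ?case by blast
qed

lemma gdiam_factor_le: "gdiam G \<le> gdiam K"
proof -
  obtain g g' where "gdiam G = gdist G g g'" by (rule gdiam_attained)
  also have "\<dots> \<le> gdist K (e g undefined) (e g' undefined)" by (simp add: gdist_e)
  also have "\<dots> \<le> gdiam K" by (rule gdist_le_gdiam)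
  finally show ?thesis .
qed

text \<open>
  The unitriangular system is solved by strong induction on \<open>i\<close>; the term for \<open>j = i\<close> has
  coefficient \<open>1\<close>, the size of a sphere of radius \<open>0\<close>.
\<close>

lemma DP_factor:
  assumes "DP K" and "DDR H"
  shows "DP G"
proof -
  let ?A = "matrix_algebra (dist_matrix G 1)"
  have "i \<le> gdiam K \<Longrightarrow> dist_matrix G i \<in> ?A" for i
  proof (induction i rule: less_induct)
    case (less i)
    let ?k = "\<lambda>j. real (card (sphere_at H j undefined))"
    have "dist_matrix K i \<in> matrix_algebra (dist_matrix K 1)"
      using assms(1) less.prems by (simp add: DP_iff_matrix_algebra[OF K])
    then obtain N where N: "N \<in> ?A" and
      sum_N: "\<And>g h g'. (\<Sum>h'\<in>UNIV. dist_matrix K i $ e g h $ e g' h') = N $ g $ g'"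
      using block_row_sum_in_matrix_algebra[OF assms(2)] by blast
    have "N $ g $ g' = ((\<Sum>j<i. ?k (i - j) *\<^sub>R dist_matrix G j) + dist_matrix G i) $ g $ g'" for g g'
      unfolding sum_N[of g undefined g', symmetric] block_row_sum_dist_matrix
      by (simp add: sphere_at_0[OF H] flip: lessThan_Suc_atMost)
    then have "N = (\<Sum>j<i. ?k (i - j) *\<^sub>R dist_matrix G j) + dist_matrix G i"
      by (simp add: vec_eq_iff)
    then have "dist_matrix G i = N - (\<Sum>j<i. ?k (i - j) *\<^sub>R dist_matrix G j)"
      by simp
    also have "\<dots> \<in> ?A"
      using less by (intro matrix_algebra_diff N matrix_algebra_sum matrix_algebra_scaleR) auto
    finally show ?case .
  qed
  then show ?thesis
    using gdiam_factor_le by (auto simp: DP_iff_matrix_algebra[OF G])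
qed

end

theorem theorem4p7:
  fixes G :: "'a::finite graph" and H :: "'b::finite graph"
  assumes "simple_connected_graph G" and "simple_connected_graph H"
  shows "(DDR (G \<box> H) \<longrightarrow> DDR G \<and> DDR H) \<and>
         (CDDR (G \<box> H) \<longrightarrow> CDDR G \<and> CDDR H) \<and>
         (DMR (G \<box> H) \<longrightarrow> DMR G \<and> DMR H) \<and>
         (DP (G \<box> H) \<longrightarrow> DP G \<and> DP H) \<and>
         (DR (G \<box> H) \<longrightarrow> DR G \<and> DR H)"
proof -
  have GH: "simple_connected_graph (G \<box> H)"
    by (rule simple_connected_graph_cartesian_product[OF assms])
  interpret left: metric_product G H "G \<box> H" "\<lambda>g h. (g, h)"
    using assms GH gdist_cartesian_product[OF assms] by unfold_locales auto
  have "bij (\<lambda>(h :: 'b, g :: 'a). (g, h))"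
    by (rule bijI) (auto simp: inj_def surj_def)
  then interpret right: metric_product H G "G \<box> H" "\<lambda>h g. (g, h)"
    using assms GH gdist_cartesian_product[OF assms] by unfold_locales auto
  have "DP (G \<box> H) \<longrightarrow> DP G \<and> DP H"
    using DP_imp_DDR[OF GH] left.DDR_factor right.DDR_factor left.DP_factor right.DP_factor
    by blast
  then show ?thesis
    using left.DDR_factor right.DDR_factor left.CDDR_factor right.CDDR_factor
      left.DMR_factor right.DMR_factor left.DR_factor right.DR_factor
    by blast
qed

end
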